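(* Consider a Supply Chain Network with $N$ nodes, routing matrix $P=(p_{ij})\in[0,1]^{N\times N}$ with spectral radius $\rho(P)<1$, row vector $\alpha=(\alpha_1,\dots,\alpha_N)$ with $\alpha_i=v_i+z_i\sigma_i$, and row vector $C=(C_1,\dots,C_N)$ of production capacities. Let the row vector $q=(q_1,\dots,q_N)$ be the (optimal) solution of the linear program $$\max\ \sum_{i=1}^N q_i\quad\text{subject to}\quad (I-P)q^{\top}\le\alpha^{\top},\qquad 0\le q\le C .$$ Let $U=\{i: q_i=C_i\}\subseteq\{1,\dots,N\}$ be the set of nodes producing at capacity, and let $\mathcal H=\{1,\dots,N\}\setminus U$. Then $$q_U^{\top}=C_U^{\top},\qquad q_{\mathcal H}^{\top}=(I_{\mathcal H}-P_{\mathcal H})^{-1}\left(\alpha_{\mathcal H}^{\top}+P_{\mathcal H,U}\,C_U^{\top}\right).$$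
   Context: A Supply Chain Network consists of nodes $1,\dots,N$. Node $i$ has external random demand with mean $v_i$ and variance $w_i^2$, production capacity $C_i$, and endogenous demand standard deviation $\sigma_i$. Its production $q_i$ is routed through the network by the routing matrix $P$, where $p_{ij}\in[0,1]$ is the proportion of the demand of node $j$ produced by node $i$. The number $z_i$ is the safety factor of node $i$. In this statement $v_i,z_i,\sigma_i$ are given real numbers, so $\alpha$ is a given real vector. All vector inequalities are componentwise. For index sets $A,B$, $P_{A,B}$ is the submatrix of $P$ with rows in $A$ and columns in $B$; $P_A:=P_{A,A}$; $I_A$ is the identity indexed by $A$; $x_A$ is the subvector of $x$ with indices in $A$. *)

theory Defs
  imports
    "Jordan_Normal_Form.Spectral_Radius"
    "Jordan_Normal_Form.Gauss_Jordan_Elimination"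
    "Jordan_Normal_Form.DL_Submatrix"
begin

(* Nodes are indexed by 0, ..., N - 1.  The type of vectors does not distinguish rows from
   columns, so transposes are left implicit. *)

(* The vector analogue of submatrix: pick A k is the k-th smallest element of A. *)
definition subvec :: "'a vec \<Rightarrow> nat set \<Rightarrow> 'a vec" where
  "subvec x A = vec (card {i. i < dim_vec x \<and> i \<in> A}) (\<lambda>k. x $ pick A k)"

(* The library order on vectors is componentwise and includes equality of dimensions. *)
definition lp_feasible :: "nat \<Rightarrow> real mat \<Rightarrow> real vec \<Rightarrow> real vec \<Rightarrow> real vec \<Rightarrow> bool" where
  "lp_feasible N P \<alpha> C q \<longleftrightarrow>
     q \<in> carrier_vec N \<and> (1\<^sub>m N - P) *\<^sub>v q \<le> \<alpha> \<and> 0\<^sub>v N \<le> q \<and> q \<le> C"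

definition lp_optimal :: "nat \<Rightarrow> real mat \<Rightarrow> real vec \<Rightarrow> real vec \<Rightarrow> real vec \<Rightarrow> bool" where
  "lp_optimal N P \<alpha> C q \<longleftrightarrow>
     lp_feasible N P \<alpha> C q \<and>
     (\<forall>x. lp_feasible N P \<alpha> C x \<longrightarrow> (\<Sum>i<N. x $ i) \<le> (\<Sum>i<N. q $ i))"

end

theory Submission
  imports Defs
begin

text \<open>At an optimum a node below capacity has a tight demand constraint: otherwise its
  production could be raised slightly, which only relaxes the constraints of the other nodes
  because \<open>P\<close> is nonnegative (\<open>lp_optimal_tight_below_capacity\<close>).  With \<open>q\<close> equal to \<open>C\<close>
  on \<open>U\<close>, the tight rows indexed by \<open>H\<close> read
  \<open>(I\<^sub>H - P\<^sub>H) q\<^sub>H = \<alpha>\<^sub>H + P\<^sub>H\<^sub>,\<^sub>U C\<^sub>U\<close>.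

  Solving this system requires \<open>I\<^sub>H - P\<^sub>H\<close> to be invertible, and this is where
  \<open>\<rho>(P) < 1\<close> enters.  A nonnegative matrix of spectral radius below one admits
  \<open>y \<le> P y\<close> only for \<open>y \<le> 0\<close>, as iteration gives \<open>y \<le> P ^ k y\<close> for
  all \<open>k\<close> and the right-hand side tends to zero (\<open>nonpos_of_le_mult_mat_vec\<close>).
  Applied to the absolute value of a kernel vector of \<open>I\<^sub>H - P\<^sub>H\<close>, extended by zero, this shows that the kernel is trivial
  (\<open>det_one_minus_principal_submatrix_nonzero\<close>).\<close>

section \<open>Nonnegative matrices of spectral radius below one\<close>

lemma spectral_radius_smult_less:
  fixes A :: "complex mat"
  assumes A: "A \<in> carrier_mat n n" and n: "n > 0"
    and c: "c > 0" and less: "c * spectral_radius A < r"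
  shows "spectral_radius (complex_of_real c \<cdot>\<^sub>m A) < r"
proof -
  let ?c = "complex_of_real c"
  have cA: "?c \<cdot>\<^sub>m A \<in> carrier_mat n n" using A by simp
  obtain ev where ev: "ev \<in> spectrum (?c \<cdot>\<^sub>m A)"
    and rad: "spectral_radius (?c \<cdot>\<^sub>m A) = norm ev"
    using spectral_radius_mem_max(1)[OF cA n] by auto
  obtain x where "eigenvector (?c \<cdot>\<^sub>m A) x ev"
    using ev unfolding spectrum_def eigenvalue_def by auto
  hence x: "x \<in> carrier_vec n" "x \<noteq> 0\<^sub>v n" and eq: "(?c \<cdot>\<^sub>m A) *\<^sub>v x = ev \<cdot>\<^sub>v x"
    using A unfolding eigenvector_def by auto
  have "A *\<^sub>v x = (ev / ?c) \<cdot>\<^sub>v x"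
  proof (rule eq_vecI)
    fix i assume "i < dim_vec ((ev / ?c) \<cdot>\<^sub>v x)"
    hence i: "i < n" using x by simp
    have "?c * (A *\<^sub>v x) $ i = ((?c \<cdot>\<^sub>m A) *\<^sub>v x) $ i"
      using i A x by simp
    also have "\<dots> = ev * x $ i" using eq i x by simp
    finally show "(A *\<^sub>v x) $ i = ((ev / ?c) \<cdot>\<^sub>v x) $ i"
      using c i x by (simp add: field_simps)
  qed (use A x in auto)
  hence "ev / ?c \<in> spectrum A"
    using x A unfolding spectrum_def eigenvalue_def eigenvector_def by auto
  hence "norm (ev / ?c) \<le> spectral_radius A"
    using spectral_radius_mem_max(2)[OF A n] by blast
  hence "norm ev \<le> c * spectral_radius A"
    using c by (simp add: norm_divide field_simps)
  thus ?thesis using rad less by simp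
qed

lemma pow_mat_nonneg:
  fixes B :: "real mat"
  assumes B: "B \<in> carrier_mat n n" and nonneg: "\<And>i j. i < n \<Longrightarrow> j < n \<Longrightarrow> 0 \<le> B $$ (i, j)"
    and "i < n" "j < n"
  shows "0 \<le> (B ^\<^sub>m k) $$ (i, j)"
  using assms(3,4)
proof (induction k arbitrary: i j)
  case 0
  thus ?case using B by simp
next
  case (Suc k)
  have "(B ^\<^sub>m k * B) $$ (i, j) = (\<Sum>l<n. (B ^\<^sub>m k) $$ (i, l) * B $$ (l, j))"
    using Suc.prems B pow_carrier_mat[OF B, of k]
    by (auto simp: scalar_prod_def atLeast0LessThan intro!: sum.cong)
  thus ?case using Suc nonneg by (auto intro!: sum_nonneg)
qed

lemma mult_mat_vec_index_sum:
  assumes "A \<in> carrier_mat m n" "x \<in> carrier_vec n" "i < m"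
  shows "(A *\<^sub>v x) $ i = (\<Sum>j<n. A $$ (i, j) * x $ j)"
  using assms by (auto simp: scalar_prod_def atLeast0LessThan)

lemma mult_mat_vec_mono:
  fixes B :: "real mat"
  assumes B: "B \<in> carrier_mat m n" and nonneg: "\<And>i j. i < m \<Longrightarrow> j < n \<Longrightarrow> 0 \<le> B $$ (i, j)"
    and x: "x \<in> carrier_vec n" and y: "y \<in> carrier_vec n"
    and le: "\<And>j. j < n \<Longrightarrow> x $ j \<le> y $ j" and i: "i < m"
  shows "(B *\<^sub>v x) $ i \<le> (B *\<^sub>v y) $ i"
  using assms by (auto simp: scalar_prod_def intro!: sum_mono mult_left_mono)

text \<open>The scaled powers \<open>B ^ k\<close> with \<open>B = t P\<close> stay bounded when \<open>t > 1\<close> is chosen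
  with \<open>t * \<rho>(P) < 1\<close>.  Since \<open>B\<close> is nonnegative, \<open>y \<le> P y\<close> iterates to
  \<open>t ^ k * y \<le> B ^ k y\<close>, so a positive entry of \<open>y\<close> would grow without bound.  In other
  words, \<open>I - P\<close> is inverse monotone.\<close>

lemma nonpos_of_le_mult_mat_vec:
  fixes P :: "real mat"
  assumes P: "P \<in> carrier_mat n n" and nonneg: "\<And>i j. i < n \<Longrightarrow> j < n \<Longrightarrow> 0 \<le> P $$ (i, j)"
    and rad: "spectral_radius (map_mat complex_of_real P) < 1"
    and y: "y \<in> carrier_vec n" and le: "\<And>i. i < n \<Longrightarrow> y $ i \<le> (P *\<^sub>v y) $ i"
    and i: "i < n"
  shows "y $ i \<le> 0"
proof -
  let ?PC = "map_mat complex_of_real P"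
  define \<rho> where "\<rho> = spectral_radius ?PC"
  \<comment> \<open>A number with \<open>t > 1\<close> and \<open>t * \<rho> < 1\<close>, also for \<open>\<rho> = 0\<close>.\<close>
  define t where "t = 2 / (1 + \<rho>)"
  define B where "B = t \<cdot>\<^sub>m P"
  have n: "n > 0" using i by simp
  have PC: "?PC \<in> carrier_mat n n" using P by simp
  have "0 \<le> \<rho>" using spectral_radius_mem_max(1)[OF PC n] unfolding \<rho>_def by auto
  hence t: "t > 1" "t * \<rho> < 1" using rad unfolding t_def \<rho>_def by (auto simp: field_simps)
  have B: "B \<in> carrier_mat n n" using P unfolding B_def by simp
  have B_nonneg: "0 \<le> B $$ (i, j)" if "i < n" "j < n" for i j
    using that nonneg P t unfolding B_def by simp
  have BC: "map_mat complex_of_real B = complex_of_real t \<cdot>\<^sub>m ?PC"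
    unfolding B_def by auto
  have "spectral_radius (map_mat complex_of_real B) < 1"
    unfolding BC using spectral_radius_smult_less[OF PC n, of t 1] t unfolding \<rho>_def by simp
  then obtain c where c: "\<And>k. norm_bound (map_mat complex_of_real B ^\<^sub>m k) c"
    using spectral_radius_jnf_norm_bound_less_1_upper_triangular[of "map_mat complex_of_real B" n] B
    by auto
  have bound: "(B ^\<^sub>m k) $$ (i, j) \<le> c" if "i < n" "j < n" for i j k
  proof -
    have "map_mat complex_of_real B ^\<^sub>m k = map_mat complex_of_real (B ^\<^sub>m k)"
      using of_real_hom.mat_hom_pow[OF B] by metis
    hence "norm (complex_of_real ((B ^\<^sub>m k) $$ (i, j))) \<le> c"
      using c[of k] that B pow_carrier_mat[OF B, of k] unfolding norm_bound_def by auto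
    thus ?thesis by simp
  qed
  have By: "t * y $ i \<le> (B *\<^sub>v y) $ i" if "i < n" for i
  proof -
    have "(B *\<^sub>v y) $ i = t * (P *\<^sub>v y) $ i" using that P y unfolding B_def by simp
    thus ?thesis using le[OF that] t by simp
  qed
  have growth: "t ^ k * y $ i \<le> (B ^\<^sub>m k *\<^sub>v y) $ i" if "i < n" for i k
    using that
  proof (induction k arbitrary: i)
    case 0
    thus ?case using B y by simp
  next
    case (Suc k)
    have Bk: "B ^\<^sub>m k \<in> carrier_mat n n" using B by simp
    have "t ^ Suc k * y $ i \<le> t * (B ^\<^sub>m k *\<^sub>v y) $ i"
      using Suc t by (simp add: mult_left_mono)
    also have "\<dots> = (B ^\<^sub>m k *\<^sub>v (t \<cdot>\<^sub>v y)) $ i"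
      using Suc.prems carrier_matD(1)[OF Bk] by (simp add: mult_mat_vec[OF Bk y])
    also have "\<dots> \<le> (B ^\<^sub>m k *\<^sub>v (B *\<^sub>v y)) $ i"
      using pow_mat_nonneg[OF B B_nonneg] By y B Suc.prems
      by (intro mult_mat_vec_mono[OF Bk]) auto
    also have "\<dots> = (B ^\<^sub>m Suc k *\<^sub>v y) $ i"
      using assoc_mult_mat_vec[OF Bk B y] by simp
    finally show ?case .
  qed
  define K where "K = (\<Sum>j<n. c * \<bar>y $ j\<bar>)"
  have upper: "t ^ k * y $ i \<le> K" for k
  proof -
    have "(B ^\<^sub>m k *\<^sub>v y) $ i = (\<Sum>j<n. (B ^\<^sub>m k) $$ (i, j) * y $ j)"
      by (rule mult_mat_vec_index_sum[OF pow_carrier_mat[OF B] y i])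
    also have "\<dots> \<le> K"
      unfolding K_def
    proof (rule sum_mono)
      fix j assume "j \<in> {..<n}"
      hence j: "j < n" by simp
      have "(B ^\<^sub>m k) $$ (i, j) * y $ j \<le> (B ^\<^sub>m k) $$ (i, j) * \<bar>y $ j\<bar>"
        using pow_mat_nonneg[OF B B_nonneg i j] by (simp add: mult_left_mono)
      also have "\<dots> \<le> c * \<bar>y $ j\<bar>" using bound[OF i j] by (simp add: mult_right_mono)
      finally show "(B ^\<^sub>m k) $$ (i, j) * y $ j \<le> c * \<bar>y $ j\<bar>" .
    qed
    finally show ?thesis using growth[OF i, of k] by simp
  qed
  show ?thesis
  proof (rule ccontr)
    assume "\<not> y $ i \<le> 0"
    hence pos: "y $ i > 0" by simp
    obtain k where "K / y $ i < t ^ k" using real_arch_pow[OF t(1)] by blast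
    thus False using upper[of k] pos by (simp add: field_simps)
  qed
qed

section \<open>Restriction to an index set\<close>

lemma bij_betw_pick:
  assumes "finite A"
  shows "bij_betw (pick A) {..<card A} A"
proof -
  have inj: "inj_on (pick A) {..<card A}"
    by (rule inj_onI) (metis lessThan_iff nat_neq_iff pick_mono_le)
  have "pick A ` {..<card A} \<subseteq> A" using pick_in_set_le by auto
  hence "pick A ` {..<card A} = A"
    using assms by (intro card_subset_eq) (auto simp: card_image[OF inj])
  thus ?thesis using inj unfolding bij_betw_def by simp
qed

lemma subvec_carrier:
  assumes "x \<in> carrier_vec n" "A \<subseteq> {..<n}"
  shows "subvec x A \<in> carrier_vec (card A)"
proof -
  have "{i. i < n \<and> i \<in> A} = A" using assms by auto
  thus ?thesis using assms unfolding subvec_def by simp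
qed

lemma subvec_index:
  assumes "x \<in> carrier_vec n" "A \<subseteq> {..<n}" "k < card A"
  shows "subvec x A $ k = x $ pick A k"
proof -
  have "{i. i < n \<and> i \<in> A} = A" using assms by auto
  thus ?thesis using assms unfolding subvec_def by simp
qed

lemma submatrix_carrier:
  assumes "M \<in> carrier_mat m n" "A \<subseteq> {..<m}" "B \<subseteq> {..<n}"
  shows "submatrix M A B \<in> carrier_mat (card A) (card B)"
proof -
  have "{i. i < m \<and> i \<in> A} = A" "{i. i < n \<and> i \<in> B} = B" using assms by auto
  thus ?thesis using assms unfolding submatrix_def by simp
qed

lemma submatrix_mult_subvec_index:
  fixes M :: "'a :: comm_semiring_1 mat"
  assumes M: "M \<in> carrier_mat m n" and A: "A \<subseteq> {..<m}" and B: "B \<subseteq> {..<n}"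
    and x: "x \<in> carrier_vec n" and k: "k < card A"
  shows "(submatrix M A B *\<^sub>v subvec x B) $ k = (\<Sum>j\<in>B. M $$ (pick A k, j) * x $ j)"
proof -
  have sets: "{i. i < dim_row M \<and> i \<in> A} = A" "{j. j < dim_col M \<and> j \<in> B} = B"
    using M A B by auto
  have fin: "finite B" using B finite_subset by blast
  have "(submatrix M A B *\<^sub>v subvec x B) $ k
      = (\<Sum>l<card B. M $$ (pick A k, pick B l) * x $ pick B l)"
    using k submatrix_carrier[OF M A B] subvec_carrier[OF x B] subvec_index[OF x B]
      submatrix_index[of k M A _ B, unfolded sets]
    by (auto simp: scalar_prod_def atLeast0LessThan intro!: sum.cong)
  also have "\<dots> = (\<Sum>j\<in>B. M $$ (pick A k, j) * x $ j)"
    by (rule sum.reindex_bij_betw[OF bij_betw_pick[OF fin], of "\<lambda>j. M $$ (pick A k, j) * x $ j"])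
  finally show ?thesis .
qed

lemma one_minus_submatrix_mult_subvec_index:
  fixes M :: "real mat"
  assumes M: "M \<in> carrier_mat n n" and A: "A \<subseteq> {..<n}"
    and x: "x \<in> carrier_vec n" and k: "k < card A"
  shows "((1\<^sub>m (card A) - submatrix M A A) *\<^sub>v subvec x A) $ k
    = x $ pick A k - (\<Sum>j\<in>A. M $$ (pick A k, j) * x $ j)"
proof -
  note carr = submatrix_carrier[OF M A A] subvec_carrier[OF x A]
  have "(1\<^sub>m (card A) - submatrix M A A) *\<^sub>v subvec x A
      = subvec x A - submatrix M A A *\<^sub>v subvec x A"
    using carr by (simp add: minus_mult_distrib_mat_vec[of _ "card A" "card A"])
  thus ?thesis
    using carr k submatrix_mult_subvec_index[OF M A A x k] subvec_index[OF x A k] by simp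
qed

lemma obtain_zero_extension:
  fixes x :: "'a :: zero vec"
  assumes x: "x \<in> carrier_vec (card A)" and A: "A \<subseteq> {..<n}"
  obtains y where "y \<in> carrier_vec n" "subvec y A = x" "\<And>j. j < n \<Longrightarrow> j \<notin> A \<Longrightarrow> y $ j = 0"
proof
  \<comment> \<open>The position of \<open>j\<close> in the increasing enumeration of \<open>A\<close> is the number of smaller
    elements of \<open>A\<close>.\<close>
  define y where "y = vec n (\<lambda>j. if j \<in> A then x $ card {a \<in> A. a < j} else 0)"
  show y: "y \<in> carrier_vec n" unfolding y_def by simp
  show "subvec y A = x"
  proof (rule eq_vecI)
    fix k assume "k < dim_vec x"
    hence k: "k < card A" using x by simp
    have "pick A k \<in> A" "pick A k < n" using pick_in_set_le[OF k] A by auto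
    thus "subvec y A $ k = x $ k"
      using subvec_index[OF y A k] card_pick_le[OF k] unfolding y_def by simp
  qed (use subvec_carrier[OF y A] x in auto)
  show "\<And>j. j < n \<Longrightarrow> j \<notin> A \<Longrightarrow> y $ j = 0" unfolding y_def by simp
qed

text \<open>If \<open>z\<close> is the zero extension of a kernel vector of \<open>I - P\<^sub>A\<close>, then its entrywise
  absolute value satisfies \<open>\<bar>z\<bar> \<le> P \<bar>z\<bar>\<close>: inside \<open>A\<close> by the triangle inequality, outside
  because \<open>P\<close> is nonnegative.  Inverse monotonicity of the full matrix forces
  \<open>z = 0\<close>.\<close>

lemma det_one_minus_principal_submatrix_nonzero:
  fixes P :: "real mat"
  assumes P: "P \<in> carrier_mat n n" and nonneg: "\<And>i j. i < n \<Longrightarrow> j < n \<Longrightarrow> 0 \<le> P $$ (i, j)"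
    and rad: "spectral_radius (map_mat complex_of_real P) < 1"
    and A: "A \<subseteq> {..<n}"
  shows "det (1\<^sub>m (card A) - submatrix P A A) \<noteq> 0"
proof
  let ?M = "1\<^sub>m (card A) - submatrix P A A"
  assume det: "det ?M = 0"
  have M: "?M \<in> carrier_mat (card A) (card A)" using submatrix_carrier[OF P A A] by (rule minus_carrier_mat)
  obtain x where x: "x \<in> carrier_vec (card A)" "x \<noteq> 0\<^sub>v (card A)"
    and ker: "?M *\<^sub>v x = 0\<^sub>v (card A)"
    using det unfolding det_0_iff_vec_prod_zero[OF M] by blast
  obtain z where z: "z \<in> carrier_vec n" and zx: "subvec z A = x"
    and z0: "\<And>j. j < n \<Longrightarrow> j \<notin> A \<Longrightarrow> z $ j = 0"
    using obtain_zero_extension[OF x(1) A] by blast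
  have fin: "finite A" using A finite_subset by blast
  define y where "y = vec n (\<lambda>j. \<bar>z $ j\<bar>)"
  have y: "y \<in> carrier_vec n" unfolding y_def by simp
  have "y $ i \<le> (P *\<^sub>v y) $ i" if i: "i < n" for i
  proof -
    have Py: "(P *\<^sub>v y) $ i = (\<Sum>j<n. P $$ (i, j) * \<bar>z $ j\<bar>)"
      using mult_mat_vec_index_sum[OF P y i] by (simp add: y_def)
    show ?thesis
    proof (cases "i \<in> A")
      case False
      thus ?thesis
        unfolding Py using z0[OF i] i nonneg by (auto simp: y_def intro!: sum_nonneg)
    next
      case True
      then obtain k where k: "k < card A" "pick A k = i"
        using bij_betw_imp_surj_on[OF bij_betw_pick[OF fin]] by (metis imageE lessThan_iff)
      have "z $ i = (\<Sum>j\<in>A. P $$ (i, j) * z $ j)"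
        using one_minus_submatrix_mult_subvec_index[OF P A z k(1)] ker k unfolding zx by simp
      hence "\<bar>z $ i\<bar> \<le> (\<Sum>j\<in>A. \<bar>P $$ (i, j) * z $ j\<bar>)" by (simp add: sum_abs)
      also have "\<dots> \<le> (\<Sum>j<n. \<bar>P $$ (i, j) * z $ j\<bar>)" using A by (intro sum_mono2) auto
      also have "\<dots> = (\<Sum>j<n. P $$ (i, j) * \<bar>z $ j\<bar>)"
        using i nonneg by (auto simp: abs_mult intro!: sum.cong)
      finally show ?thesis unfolding Py using i by (simp add: y_def)
    qed
  qed
  hence "y $ i \<le> 0" if "i < n" for i
    using nonpos_of_le_mult_mat_vec[OF P nonneg rad y _ that] by blast
  hence z_zero: "z $ i = 0" if "i < n" for i using that unfolding y_def by fastforce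
  have "x $ k = 0" if k: "k < card A" for k
    using subvec_index[OF z A k] z_zero pick_in_set_le[OF k] A unfolding zx by auto
  hence "x = 0\<^sub>v (card A)" using x(1) by (intro eq_vecI) auto
  thus False using x(2) by contradiction
qed

lemma mat_inverse_of_det_nonzero:
  fixes M :: "'a :: field mat"
  assumes M: "M \<in> carrier_mat n n" and det: "det M \<noteq> 0"
  shows "invertible_mat M"
    and "x \<in> carrier_vec n \<Longrightarrow> the (mat_inverse M) *\<^sub>v (M *\<^sub>v x) = x"
proof -
  have "M \<in> Units (ring_mat TYPE('a) n n)" using det_non_zero_imp_unit[OF M det] .
  then obtain B where B: "mat_inverse M = Some B" using mat_inverse(1)[OF M] by fastforce
  note inv = mat_inverse(2)[OF M B]
  show "invertible_mat M"
    using inv M unfolding invertible_mat_def inverts_mat_def by auto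
  show "the (mat_inverse M) *\<^sub>v (M *\<^sub>v x) = x" if "x \<in> carrier_vec n"
    using assoc_mult_mat_vec[of B n n M n x] that inv M B by simp
qed

section \<open>Optimal production plans\<close>

lemma lp_feasible_iff:
  assumes P: "P \<in> carrier_mat N N" and \<alpha>: "\<alpha> \<in> carrier_vec N" and C: "C \<in> carrier_vec N"
  shows "lp_feasible N P \<alpha> C x \<longleftrightarrow> x \<in> carrier_vec N \<and>
    (\<forall>i<N. x $ i - (\<Sum>j<N. P $$ (i, j) * x $ j) \<le> \<alpha> $ i \<and> 0 \<le> x $ i \<and> x $ i \<le> C $ i)"
proof (cases "x \<in> carrier_vec N")
  case x: True
  have "((1\<^sub>m N - P) *\<^sub>v x) $ i = x $ i - (\<Sum>j<N. P $$ (i, j) * x $ j)" if i: "i < N" for i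
  proof -
    have "(1\<^sub>m N - P) *\<^sub>v x = x - P *\<^sub>v x"
      using P x by (simp add: minus_mult_distrib_mat_vec[of _ N N])
    thus ?thesis using mult_mat_vec_index_sum[OF P x i] i P x by simp
  qed
  thus ?thesis
    using P \<alpha> C x unfolding lp_feasible_def less_eq_vec_def by auto
qed (simp add: lp_feasible_def)

text \<open>Raising the production of a single node \<open>i\<close> by \<open>e > 0\<close> raises the left-hand side of
  its own constraint by at most \<open>e\<close> and can only lower that of the others.  So slack both in
  constraint \<open>i\<close> and in the capacity of \<open>i\<close> would leave room for a better plan.\<close>

lemma lp_optimal_tight_below_capacity:
  assumes P: "P \<in> carrier_mat N N" and \<alpha>: "\<alpha> \<in> carrier_vec N" and C: "C \<in> carrier_vec N"
    and nonneg: "\<And>i j. i < N \<Longrightarrow> j < N \<Longrightarrow> 0 \<le> P $$ (i, j)"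
    and opt: "lp_optimal N P \<alpha> C q" and i: "i < N" and below: "q $ i \<noteq> C $ i"
  shows "q $ i - (\<Sum>j<N. P $$ (i, j) * q $ j) = \<alpha> $ i"
proof (rule ccontr)
  define s where "s = \<alpha> $ i - (q $ i - (\<Sum>j<N. P $$ (i, j) * q $ j))"
  assume not_tight: "\<not> ?thesis"
  have q: "q \<in> carrier_vec N" and feas: "\<And>k. k < N \<Longrightarrow>
      q $ k - (\<Sum>j<N. P $$ (k, j) * q $ j) \<le> \<alpha> $ k \<and> 0 \<le> q $ k \<and> q $ k \<le> C $ k"
    and best: "\<And>x. lp_feasible N P \<alpha> C x \<Longrightarrow> (\<Sum>j<N. x $ j) \<le> (\<Sum>j<N. q $ j)"
    using opt unfolding lp_optimal_def lp_feasible_iff[OF P \<alpha> C] by auto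
  define e where "e = min s (C $ i - q $ i)"
  have e: "e > 0" "e \<le> s" "e \<le> C $ i - q $ i"
    using feas[OF i] not_tight below unfolding e_def s_def by auto
  define x where "x = vec N (\<lambda>j. q $ j + (if j = i then e else 0))"
  have row: "(\<Sum>j<N. P $$ (k, j) * x $ j) = (\<Sum>j<N. P $$ (k, j) * q $ j) + P $$ (k, i) * e" for k
  proof -
    have "(\<Sum>j<N. P $$ (k, j) * x $ j)
        = (\<Sum>j<N. P $$ (k, j) * q $ j + (if j = i then P $$ (k, j) * e else 0))"
      unfolding x_def by (intro sum.cong) (auto simp: algebra_simps)
    thus ?thesis using i by (simp add: sum.distrib)
  qed
  have "lp_feasible N P \<alpha> C x"
    unfolding lp_feasible_iff[OF P \<alpha> C]
  proof (intro conjI allI impI)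
    show "x \<in> carrier_vec N" unfolding x_def by simp
    fix k assume k: "k < N"
    have "0 \<le> P $$ (k, i) * e" using nonneg[OF k i] e by simp
    thus "x $ k - (\<Sum>j<N. P $$ (k, j) * x $ j) \<le> \<alpha> $ k"
      unfolding row using feas[OF k] e k unfolding s_def x_def by auto
    show "0 \<le> x $ k" "x $ k \<le> C $ k" using feas[OF k] e k unfolding x_def by auto
  qed
  hence "(\<Sum>j<N. x $ j) \<le> (\<Sum>j<N. q $ j)" by (rule best)
  moreover have "(\<Sum>j<N. x $ j) = (\<Sum>j<N. q $ j) + e"
    using i unfolding x_def by (simp add: sum.distrib)
  ultimately show False using e by simp
qed

theorem theorem2:
  fixes N :: nat
    and P :: "real mat"
    and v z \<sigma> \<alpha> C q :: "real vec"
    and U H :: "nat set"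
  assumes "P \<in> carrier_mat N N"
    and "\<forall>i<N. \<forall>j<N. P $$ (i, j) \<in> {0..1}"
    and "spectral_radius (map_mat complex_of_real P) < 1"
    and "v \<in> carrier_vec N" and "z \<in> carrier_vec N" and "\<sigma> \<in> carrier_vec N"
    and "\<alpha> = vec N (\<lambda>i. v $ i + z $ i * \<sigma> $ i)"
    and "C \<in> carrier_vec N"
    and "lp_optimal N P \<alpha> C q"
    and "U = {i. i < N \<and> q $ i = C $ i}"
    and "H = {..<N} - U"
  shows "subvec q U = subvec C U \<and>
    invertible_mat (1\<^sub>m (card H) - submatrix P H H) \<and>
    subvec q H =
      the (mat_inverse (1\<^sub>m (card H) - submatrix P H H)) *\<^sub>v
        (subvec \<alpha> H + submatrix P H U *\<^sub>v subvec C U)"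
proof -
  let ?M = "1\<^sub>m (card H) - submatrix P H H"
  have P: "P \<in> carrier_mat N N" and C: "C \<in> carrier_vec N" using assms by auto
  have \<alpha>: "\<alpha> \<in> carrier_vec N" using assms(7) by simp
  have nonneg: "\<And>i j. i < N \<Longrightarrow> j < N \<Longrightarrow> 0 \<le> P $$ (i, j)" using assms(2) by auto
  have q: "q \<in> carrier_vec N" using assms(9) unfolding lp_optimal_def lp_feasible_def by simp
  have U: "U \<subseteq> {..<N}" and H: "H \<subseteq> {..<N}" using assms(10,11) by auto
  have qU: "subvec q U = subvec C U"
  proof (rule eq_vecI)
    fix k assume "k < dim_vec (subvec C U)"
    hence k: "k < card U" using subvec_carrier[OF C U] by simp
    show "subvec q U $ k = subvec C U $ k"
      using subvec_index[OF q U k] subvec_index[OF C U k] pick_in_set_le[OF k] assms(10) by simp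
  qed (use subvec_carrier[OF C U] subvec_carrier[OF q U] in auto)
  have M: "?M \<in> carrier_mat (card H) (card H)" using submatrix_carrier[OF P H H] by (rule minus_carrier_mat)
  have "det ?M \<noteq> 0"
    using det_one_minus_principal_submatrix_nonzero[OF P nonneg assms(3) H] by blast
  note inv = mat_inverse_of_det_nonzero[OF M this]
  have "?M *\<^sub>v subvec q H = subvec \<alpha> H + submatrix P H U *\<^sub>v subvec C U"
  proof (rule eq_vecI)
    note dims = subvec_carrier[OF \<alpha> H] submatrix_carrier[OF P H U] submatrix_carrier[OF P H H]
    show "dim_vec (?M *\<^sub>v subvec q H) = dim_vec (subvec \<alpha> H + submatrix P H U *\<^sub>v subvec C U)"
      using dims by simp
    fix k assume "k < dim_vec (subvec \<alpha> H + submatrix P H U *\<^sub>v subvec C U)"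
    hence k: "k < card H" using dims by simp
    define i where "i = pick H k"
    have i: "i < N" "q $ i \<noteq> C $ i"
      using pick_in_set_le[OF k] assms(10,11) unfolding i_def by auto
    have "{..<N} = H \<union> U" "H \<inter> U = {}" using assms(10,11) by auto
    moreover have "finite H" "finite U" using U H finite_subset by blast+
    ultimately have split: "(\<Sum>j<N. P $$ (i, j) * q $ j)
        = (\<Sum>j\<in>H. P $$ (i, j) * q $ j) + (\<Sum>j\<in>U. P $$ (i, j) * q $ j)"
      by (metis sum.union_disjoint)
    have "(?M *\<^sub>v subvec q H) $ k = q $ i - (\<Sum>j\<in>H. P $$ (i, j) * q $ j)"
      using one_minus_submatrix_mult_subvec_index[OF P H q k] unfolding i_def .
    also have "\<dots> = \<alpha> $ i + (\<Sum>j\<in>U. P $$ (i, j) * q $ j)"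
      using lp_optimal_tight_below_capacity[OF P \<alpha> C nonneg assms(9) i] split by simp
    also have "\<dots> = (subvec \<alpha> H + submatrix P H U *\<^sub>v subvec q U) $ k"
      using submatrix_mult_subvec_index[OF P H U q k] subvec_index[OF \<alpha> H k] k dims
      unfolding i_def by simp
    finally show "(?M *\<^sub>v subvec q H) $ k
        = (subvec \<alpha> H + submatrix P H U *\<^sub>v subvec C U) $ k"
      unfolding qU .
  qed
  thus ?thesis using qU inv(1) inv(2)[OF subvec_carrier[OF q H]] by simp
qed

end
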